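(* Let $\mathfrak g$ be a complex simple Lie algebra having roots of two different lengths, with root system $\Delta$, simple roots $\Pi$, Weyl group $W$ and Coxeter number $h$. Let $h_s$ be the Coxeter number of the root system $\Delta(\Pi_s)=\Delta\cap\mathbb Z\Pi_s$. Let $c\in W$ be a Coxeter element associated with $\Pi$. Then $c^{h_s}\in W_l$ and $h/h_s\in\mathbb N$.
   Context: $\Pi_s\subset\Pi$ is the set of short simple roots; $\Delta(\Pi_s)$ is an irreducible (simply-laced) root system with simple roots $\Pi_s$, so its Coxeter number is well defined. $W_l$ is the subgroup of $W$ generated by the reflections $r_\gamma$ in the long roots $\gamma$. A Coxeter element associated with $\Pi$ is a product of all simple reflections $r_\alpha$, $\alpha\in\Pi$, each taken once, in some order. *)

theory Defs
  imports
    "HOL-Analysis.Analysis"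
    "HOL-Algebra.Generated_Groups"
    "HOL-Algebra.Multiplicative_Group"
begin

text \<open>The orthogonal group of a Euclidean space. Weyl groups are realised as subgroups of it.\<close>

definition orth_group :: "('a::euclidean_space \<Rightarrow> 'a) monoid" where
  "orth_group = \<lparr>carrier = {f. orthogonal_transformation f}, monoid.mult = (\<circ>), one = id\<rparr>"

lemma group_orth_group: "group (orth_group :: ('a::euclidean_space \<Rightarrow> 'a) monoid)"
proof (rule groupI)
  fix f :: "'a \<Rightarrow> 'a"
  assume "f \<in> carrier orth_group"
  then have f: "orthogonal_transformation f"
    by (simp add: orth_group_def)
  show "\<exists>g\<in>carrier orth_group. g \<otimes>\<^bsub>orth_group\<^esub> f = \<one>\<^bsub>orth_group\<^esub>"
    using orthogonal_transformation_inv[OF f] orthogonal_transformation_inj[OF f]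
    by (intro bexI[of _ "Hilbert_Choice.inv f"]) (auto simp: orth_group_def)
qed (auto simp: orth_group_def orthogonal_transformation_compose[unfolded o_def] id_def o_def)

definition reflection :: "'a::euclidean_space \<Rightarrow> 'a \<Rightarrow> 'a" where
  "reflection \<alpha> x = x - (2 * (x \<bullet> \<alpha>) / (\<alpha> \<bullet> \<alpha>)) *\<^sub>R \<alpha>"

lemma reflection_in_orth_group:
  assumes "\<alpha> \<noteq> (0::'a::euclidean_space)"
  shows "reflection \<alpha> \<in> carrier orth_group"
proof -
  have "linear (reflection \<alpha>)"
    by (rule linearI)
      (auto simp: reflection_def algebra_simps inner_add_left add_divide_distrib scaleR_add_left)
  moreover have "reflection \<alpha> v \<bullet> reflection \<alpha> w = v \<bullet> w" for v w
    using assms by (simp add: reflection_def inner_diff_left inner_diff_right inner_commute field_simps)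
  ultimately show ?thesis
    by (auto simp: orth_group_def orthogonal_transformation_def)
qed

text \<open>
  Reduced crystallographic root systems. A set of roots is a root system in the subspace it spans,
  which need not be the whole ambient space: this lets the same notion apply to a root subsystem of
  smaller rank. Reflections fix the orthogonal complement of that subspace pointwise, so passing to
  the ambient space changes neither the Weyl group nor the orders of its elements.
\<close>

definition root_system :: "'a::euclidean_space set \<Rightarrow> bool" where
  "root_system \<Delta> \<longleftrightarrow>
     finite \<Delta> \<and> 0 \<notin> \<Delta> \<and>
     (\<forall>\<alpha>\<in>\<Delta>. reflection \<alpha> ` \<Delta> = \<Delta>) \<and>
     (\<forall>\<alpha>\<in>\<Delta>. \<forall>\<beta>\<in>\<Delta>. 2 * (\<beta> \<bullet> \<alpha>) / (\<alpha> \<bullet> \<alpha>) \<in> \<int>) \<and>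
     (\<forall>\<alpha>\<in>\<Delta>. \<Delta> \<inter> span {\<alpha>} = {\<alpha>, - \<alpha>})"

definition irreducible_root_system :: "'a::euclidean_space set \<Rightarrow> bool" where
  "irreducible_root_system \<Delta> \<longleftrightarrow>
     root_system \<Delta> \<and> \<Delta> \<noteq> {} \<and>
     (\<nexists>A B. A \<noteq> {} \<and> B \<noteq> {} \<and> A \<union> B = \<Delta> \<and> A \<inter> B = {} \<and> (\<forall>\<alpha>\<in>A. \<forall>\<beta>\<in>B. \<alpha> \<bullet> \<beta> = 0))"

definition simple_roots :: "'a::euclidean_space set \<Rightarrow> 'a set \<Rightarrow> bool" where
  "simple_roots \<Delta> B \<longleftrightarrow>
     B \<subseteq> \<Delta> \<and> independent B \<and>
     (\<forall>\<beta>\<in>\<Delta>. \<exists>k :: 'a \<Rightarrow> nat.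
        \<beta> = (\<Sum>\<alpha>\<in>B. real (k \<alpha>) *\<^sub>R \<alpha>) \<or> \<beta> = - (\<Sum>\<alpha>\<in>B. real (k \<alpha>) *\<^sub>R \<alpha>))"

text \<open>Only meaningful for finite sets.\<close>

definition int_span :: "'a::real_vector set \<Rightarrow> 'a set" where
  "int_span S = {\<Sum>\<alpha>\<in>S. of_int (k \<alpha>) *\<^sub>R \<alpha> | k :: 'a \<Rightarrow> int. True}"

definition reflection_group :: "'a::euclidean_space set \<Rightarrow> ('a \<Rightarrow> 'a) set" where
  "reflection_group R = generate orth_group (reflection ` R)"

abbreviation weyl_group :: "'a::euclidean_space set \<Rightarrow> ('a \<Rightarrow> 'a) set" where
  "weyl_group \<Delta> \<equiv> reflection_group \<Delta>"

definition long_roots :: "'a::euclidean_space set \<Rightarrow> 'a set" where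
  "long_roots \<Delta> = {\<alpha> \<in> \<Delta>. norm \<alpha> = Max (norm ` \<Delta>)}"

definition short_roots :: "'a::euclidean_space set \<Rightarrow> 'a set" where
  "short_roots \<Delta> = {\<alpha> \<in> \<Delta>. norm \<alpha> = Min (norm ` \<Delta>)}"

definition coxeter_element :: "'a::euclidean_space set \<Rightarrow> ('a \<Rightarrow> 'a) \<Rightarrow> bool" where
  "coxeter_element B c \<longleftrightarrow>
     (\<exists>\<alpha>s. distinct \<alpha>s \<and> set \<alpha>s = B \<and> c = foldr (\<circ>) (map reflection \<alpha>s) id)"

text \<open>
  The Coxeter number is the common order of all Coxeter elements, over all systems of simple roots;
  that they do have the same order is a theorem, so the description is well defined.
\<close>

definition coxeter_number :: "'a::euclidean_space set \<Rightarrow> nat" where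
  "coxeter_number \<Delta> =
     (THE n. \<forall>B c. simple_roots \<Delta> B \<and> coxeter_element B c \<longrightarrow> group.ord orth_group c = n)"

end

theory Submission
  imports Defs
begin

text \<open>
  The group generated by the long reflections is normalised by the Weyl group, and every simple
  root is long or short. Modulo the long reflections, a Coxeter element \<open>c\<close> therefore
  becomes the product \<open>c\<^sub>s\<close> of its short simple reflections, taken in the same order; this
  is a Coxeter element for the short simple roots. Raising to the power \<open>h\<^sub>s\<close> gives the
  first claim. For the second, \<open>c\<^sub>s\<close> raised to the power \<open>h\<close> is a product of long
  reflections. Short simple reflections permute the positive long roots, so this element preserves
  the positive system of the long root system, and an element of a Weyl group preserving a positive
  system is trivial.

  Reading \<open>h\<close> and \<open>h\<^sub>s\<close> as orders of \<open>c\<close> and \<open>c\<^sub>s\<close> requires that all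
  Coxeter elements be conjugate. Simple systems are conjugate by a walk through the chambers, and
  for a fixed simple system the Dynkin diagram is a forest, so that any two orderings are related by
  cyclic rotations and by exchanges of commuting neighbours.
\<close>

section \<open>Reflections and their products\<close>

lemma linear_reflection: "linear (reflection a)"
  by (rule linearI)
    (auto simp: reflection_def algebra_simps inner_add_left add_divide_distrib scaleR_add_left)

lemma orthogonal_transformation_reflection: "orthogonal_transformation (reflection a)"
proof (cases "a = 0")
  case True
  then have "reflection a = (\<lambda>x. x)"
    by (auto simp: reflection_def)
  then show ?thesis by simp
next
  case False
  then show ?thesis
    using reflection_in_orth_group[of a] by (simp add: orth_group_def)
qed

lemma reflection_self: "reflection a a = - a"
  by (cases "a = 0") (auto simp: reflection_def scaleR_2)

lemma reflection_uminus: "reflection (- a) = reflection a"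
  by (auto simp: reflection_def)

lemma reflection_reflection [simp]: "reflection a (reflection a x) = x"
proof (cases "a = 0")
  case False
  then show ?thesis
    by (simp add: reflection_def inner_diff_left field_simps flip: scaleR_left.add scaleR_left.diff)
qed (simp add: reflection_def)

lemma reflection_orthogonal_transformation:
  assumes "orthogonal_transformation w"
  shows "reflection (w a) (w x) = w (reflection a x)"
proof -
  have "linear w" and "\<And>x y. w x \<bullet> w y = x \<bullet> y"
    using assms by (auto simp: orthogonal_transformation_def)
  then show ?thesis
    by (simp add: reflection_def linear_diff linear_scale)
qed

lemma reflection_commute:
  assumes "a \<bullet> b = 0"
  shows "reflection a (reflection b x) = reflection b (reflection a x)"
  using assms by (simp add: reflection_def inner_diff_left inner_diff_right inner_commute)

text \<open>The product in \<open>coxeter_element\<close>, named so that Coxeter elements can be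
  handled as words; the last letter acts first.\<close>

definition reflection_prod :: "'a::euclidean_space list \<Rightarrow> 'a \<Rightarrow> 'a" where
  "reflection_prod l = foldr (\<circ>) (map reflection l) id"

lemma reflection_prod_simps [simp]:
  "reflection_prod [] = id"
  "reflection_prod (a # l) = reflection a \<circ> reflection_prod l"
  by (auto simp: reflection_prod_def)

lemma reflection_prod_append [simp]:
  "reflection_prod (l @ m) = reflection_prod l \<circ> reflection_prod m"
  by (induction l) (auto simp: o_assoc)

lemma orthogonal_transformation_reflection_prod:
  "orthogonal_transformation (reflection_prod l)"
proof (induction l)
  case (Cons a l)
  then show ?case
    using orthogonal_transformation_compose[OF orthogonal_transformation_reflection] by (auto simp: o_def)
qed (simp add: id_def)

lemma reflection_prod_map:
  assumes "orthogonal_transformation w"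
  shows "reflection_prod (map w l) (w x) = w (reflection_prod l x)"
  by (induction l) (auto simp: reflection_orthogonal_transformation[OF assms])

lemma coxeter_element_iff:
  "coxeter_element B c \<longleftrightarrow> (\<exists>l. distinct l \<and> set l = B \<and> c = reflection_prod l)"
  by (auto simp: coxeter_element_def reflection_prod_def)

lemma orth_group_pow: "f [^]\<^bsub>orth_group\<^esub> (n::nat) = f ^^ n"
  by (induction n) (auto simp: nat_pow_def orth_group_def funpow_Suc_right simp del: funpow.simps(2))

text \<open>Orders are used below through this divisibility test. It also covers infinite order,
  where \<open>group.ord\<close> is 0.\<close>

lemma orth_group_ord:
  assumes "orthogonal_transformation c"
  shows "c ^^ n = id \<longleftrightarrow> group.ord orth_group c dvd n"
proof -
  have "c \<in> carrier orth_group"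
    using assms by (simp add: orth_group_def)
  from group.pow_eq_id[OF group_orth_group this, of n] show ?thesis
    by (simp add: orth_group_pow) (simp add: orth_group_def)
qed

text \<open>Conjugation carries powers to powers, so both elements are killed by the same exponents,
  and naturals with the same multiples are equal.\<close>

lemma orth_group_ord_conj:
  fixes c c' :: "'a::euclidean_space \<Rightarrow> 'a"
  assumes "orthogonal_transformation c" "orthogonal_transformation c'"
    and "orthogonal_transformation w" and conj: "c' \<circ> w = w \<circ> c"
  shows "group.ord orth_group c' = group.ord orth_group c"
proof -
  have pow: "(c' ^^ n) (w x) = w ((c ^^ n) x)" for n x
    using conj by (induction n) (auto simp: fun_eq_iff)
  have "c' ^^ n = id \<longleftrightarrow> c ^^ n = id" for n
  proof
    assume "c' ^^ n = id"
    then show "c ^^ n = id"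
      using pow[of n] orthogonal_transformation_inj[OF assms(3)] by (auto simp: fun_eq_iff inj_def)
  next
    assume "c ^^ n = id"
    then show "c' ^^ n = id"
      using pow[of n] orthogonal_transformation_surj[OF assms(3)] by (metis eq_id_iff surj_def)
  qed
  then have "group.ord orth_group c' dvd n \<longleftrightarrow> group.ord orth_group c dvd n" for n
    by (simp add: assms orth_group_ord[symmetric])
  then show ?thesis
    by (meson dvd_antisym dvd_refl)
qed

section \<open>Closure properties of root systems\<close>

lemma root_system_uminus:
  assumes "root_system R" "b \<in> R"
  shows "- b \<in> R"
  using assms unfolding root_system_def by (metis image_eqI reflection_self)

lemma root_system_reflection:
  assumes "root_system R" "a \<in> R" "b \<in> R"
  shows "reflection a b \<in> R"
  using assms unfolding root_system_def by blast

lemma root_system_nonzero: "root_system R \<Longrightarrow> b \<in> R \<Longrightarrow> b \<noteq> 0"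
  by (auto simp: root_system_def)

lemma root_system_multiple:
  assumes "root_system R" "a \<in> R" "b \<in> R" "b = t *\<^sub>R a"
  shows "b = a \<or> b = - a"
proof -
  have "b \<in> R \<inter> span {a}"
    using assms by (auto simp: span_singleton)
  then show ?thesis
    using assms unfolding root_system_def by auto
qed

text \<open>Integrality and reducedness restrict to subsets. Closure supplies the rest:
  \<open>reflection a a = - a\<close> gives negatives, and involutivity turns inclusion of images
  into equality.\<close>

lemma root_system_closed_subset:
  assumes "root_system R" "S \<subseteq> R"
    and cl: "\<And>a b. a \<in> S \<Longrightarrow> b \<in> S \<Longrightarrow> reflection a b \<in> S"
  shows "root_system S"
proof -
  have um: "- a \<in> S" if "a \<in> S" for a
    using cl[OF that that] by (simp add: reflection_self)
  have 1: "reflection a ` S = S" if "a \<in> S" for a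
  proof
    show "S \<subseteq> reflection a ` S"
      using cl[OF that] by (metis image_iff reflection_reflection subsetI)
  qed (use cl[OF that] in auto)
  have 2: "S \<inter> span {a} = {a, - a}" if "a \<in> S" for a
  proof -
    have "R \<inter> span {a} = {a, - a}"
      using assms(1,2) that unfolding root_system_def by blast
    then show ?thesis
      using assms(2) that um[OF that] by blast
  qed
  have "finite S" "0 \<notin> S"
    using assms(1,2) finite_subset[OF assms(2)] unfolding root_system_def by auto
  moreover have "\<forall>a\<in>S. \<forall>b\<in>S. 2 * (b \<bullet> a) / (a \<bullet> a) \<in> \<int>"
    using assms(1,2) unfolding root_system_def by (meson subsetD)
  ultimately show ?thesis
    using 1 2 by (simp add: root_system_def)
qed

section \<open>Systems of simple roots\<close>

text \<open>The functional \<open>f\<close> encodes the positive system by its sign on roots. Signs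
  are easier to follow through reflections and to restrict to subsystems than coefficients.\<close>

locale based_root_system =
  fixes R B :: "'a::euclidean_space set" and f :: "'a \<Rightarrow> real"
  assumes rs: "root_system R" and simple: "simple_roots R B"
    and lin: "linear f" and pos: "a \<in> B \<Longrightarrow> 0 < f a"
begin

lemma fin: "finite R"
  using rs by (simp add: root_system_def)

lemma sub: "B \<subseteq> R" and indep: "independent B"
  using simple by (auto simp: simple_roots_def)

lemma finB: "finite B"
  using sub fin by (rule finite_subset)

lemma f_sum: "f (\<Sum>a\<in>B. real (k a) *\<^sub>R a) = (\<Sum>a\<in>B. real (k a) * f a)"
  by (simp add: linear_sum[OF lin] linear_scale[OF lin])

text \<open>In the negative case \<open>0 \<le> f b\<close> would force every coefficient to vanish.
  The weak inequality lets \<open>regular\<close> apply this to a hypothetical root with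
  \<open>f b = 0\<close>.\<close>

lemma expansion:
  assumes "b \<in> R" "0 \<le> f b"
  obtains k :: "'a \<Rightarrow> nat" where "b = (\<Sum>a\<in>B. real (k a) *\<^sub>R a)"
proof -
  obtain k :: "'a \<Rightarrow> nat" where k: "b = (\<Sum>a\<in>B. real (k a) *\<^sub>R a) \<or> b = - (\<Sum>a\<in>B. real (k a) *\<^sub>R a)"
    using simple assms(1) unfolding simple_roots_def by blast
  show thesis
  proof (cases "b = (\<Sum>a\<in>B. real (k a) *\<^sub>R a)")
    case False
    then have b: "b = - (\<Sum>a\<in>B. real (k a) *\<^sub>R a)" using k by simp
    then have "(\<Sum>a\<in>B. real (k a) * f a) \<le> 0"
      using assms(2) f_sum[of k] by (simp add: linear_neg[OF lin])
    moreover have "\<forall>a\<in>B. 0 \<le> real (k a) * f a"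
      by (intro ballI mult_nonneg_nonneg less_imp_le[OF pos]) auto
    ultimately have "(\<Sum>a\<in>B. real (k a) * f a) = 0"
      by (meson order_antisym sum_nonneg)
    then have "\<forall>a\<in>B. real (k a) * f a = 0"
      using \<open>\<forall>a\<in>B. 0 \<le> real (k a) * f a\<close> finB by (simp add: sum_nonneg_eq_0_iff)
    then have "\<forall>a\<in>B. k a = 0" using pos by fastforce
    then have "b = 0" using b by simp
    then show thesis using assms(1) rs root_system_nonzero by blast
  qed (use that in blast)
qed

lemma coeff_unique:
  assumes "(\<Sum>a\<in>B. u a *\<^sub>R a) = (\<Sum>a\<in>B. u' a *\<^sub>R a)" "a \<in> B"
  shows "u a = u' a"
proof -
  have "(\<Sum>a\<in>B. (u a - u' a) *\<^sub>R a) = 0"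
    using assms(1) by (simp add: scaleR_diff_left sum_subtractf)
  from independentD[OF indep finB order_refl this assms(2)] show ?thesis by simp
qed

text \<open>Otherwise \<open>b\<close> and \<open>- b\<close> would both have nonnegative
  expansions; these add up to 0, so independence makes all coefficients vanish.\<close>

lemma regular:
  assumes "b \<in> R"
  shows "f b \<noteq> 0"
proof
  assume 0: "f b = 0"
  then obtain k :: "'a \<Rightarrow> nat" where k: "b = (\<Sum>a\<in>B. real (k a) *\<^sub>R a)"
    using expansion[OF assms eq_refl[OF 0[symmetric]]] by blast
  moreover obtain m :: "'a \<Rightarrow> nat" where m: "- b = (\<Sum>a\<in>B. real (m a) *\<^sub>R a)"
    using expansion[of "- b"] assms 0 root_system_uminus[OF rs] by (auto simp: linear_neg[OF lin])
  ultimately have "(\<Sum>a\<in>B. (real (k a) + real (m a)) *\<^sub>R a) = (\<Sum>a\<in>B. 0 *\<^sub>R a)"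
    by (simp add: scaleR_add_left sum.distrib flip: m k)
  from coeff_unique[OF this] have "real (k a) + real (m a) = 0" if "a \<in> B" for a
    using that by blast
  then have "k a = 0" if "a \<in> B" for a using that by force
  then have "b = 0" using k by simp
  then show False using assms rs root_system_nonzero by blast
qed

text \<open>The reflection in \<open>a\<close> alters only the coefficient of \<open>a\<close>. If
  \<open>b\<close> became negative, its other coefficients would be 0, and reducedness would leave
  only \<open>a\<close> and \<open>- a\<close>.\<close>

lemma simple_reflection_pos:
  assumes a: "a \<in> B" and b: "b \<in> R" "0 < f b" "b \<noteq> a"
  shows "0 < f (reflection a b)"
proof (rule ccontr)
  let ?c = "reflection a b"
  have aR: "a \<in> R" using a sub by blast
  assume "\<not> 0 < f ?c"
  then have "0 \<le> f (- ?c)" by (simp add: linear_neg[OF lin])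
  moreover have "- ?c \<in> R"
    using root_system_reflection[OF rs aR b(1)] root_system_uminus[OF rs] by blast
  ultimately obtain m :: "'a \<Rightarrow> nat" where m: "- ?c = (\<Sum>x\<in>B. real (m x) *\<^sub>R x)"
    using expansion by blast
  obtain k :: "'a \<Rightarrow> nat" where k: "b = (\<Sum>x\<in>B. real (k x) *\<^sub>R x)"
    using expansion[OF b(1) less_imp_le[OF b(2)]] by blast
  define t where "t = 2 * (b \<bullet> a) / (a \<bullet> a)"
  have "- ?c + b = t *\<^sub>R a" by (simp add: reflection_def t_def)
  also have "\<dots> = (\<Sum>x\<in>B. (if x = a then t else 0) *\<^sub>R x)"
    using a finB by (simp add: if_distrib[where f = "\<lambda>u. u *\<^sub>R _"] sum.delta cong: if_cong)
  finally have "(\<Sum>x\<in>B. (real (m x) + real (k x)) *\<^sub>R x) = (\<Sum>x\<in>B. (if x = a then t else 0) *\<^sub>R x)"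
    by (simp add: scaleR_add_left sum.distrib flip: m k)
  from coeff_unique[OF this] have "real (m x) + real (k x) = (if x = a then t else 0)"
    if "x \<in> B" for x
    using that by blast
  then have "k x = 0" if "x \<in> B" "x \<noteq> a" for x using that by force
  then have "b = (\<Sum>x\<in>B. if x = a then real (k a) *\<^sub>R a else 0)"
    unfolding k by (intro sum.cong) auto
  then have "b = real (k a) *\<^sub>R a" using a finB by simp
  then have "b = - a" using root_system_multiple[OF rs aR b(1)] b(3) by blast
  then show False using b(2) pos[OF a] by (simp add: linear_neg[OF lin])
qed

text \<open>Recovers the base from the signs of \<open>f\<close> alone, so functionals with equal
  signs on \<open>R\<close> have equal bases. A positive root outside \<open>B\<close> fails the
  test: reflecting its own expansion term by term would give \<open>0 \<le> f (- a)\<close>.\<close>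

lemma simple_eq:
  "B = {a \<in> R. 0 < f a \<and> (\<forall>b\<in>R. 0 < f b \<longrightarrow> b \<noteq> a \<longrightarrow> 0 < f (reflection a b))}" (is "_ = ?S")
proof
  show "B \<subseteq> ?S" using simple_reflection_pos sub pos by blast
  show "?S \<subseteq> B"
  proof
    fix a assume "a \<in> ?S"
    then have a: "a \<in> R" "0 < f a"
      and refl: "\<And>b. b \<in> R \<Longrightarrow> 0 < f b \<Longrightarrow> b \<noteq> a \<Longrightarrow> 0 < f (reflection a b)" by auto
    obtain k :: "'a \<Rightarrow> nat" where k: "a = (\<Sum>x\<in>B. real (k x) *\<^sub>R x)"
      using expansion[OF a(1) less_imp_le[OF a(2)]] by blast
    show "a \<in> B"
    proof (rule ccontr)
      assume "a \<notin> B"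
      then have "0 \<le> real (k x) * f (reflection a x)" if "x \<in> B" for x
        using that sub pos[OF that] by (intro mult_nonneg_nonneg less_imp_le[OF refl]) auto
      then have "0 \<le> (\<Sum>x\<in>B. real (k x) * f (reflection a x))" by (rule sum_nonneg)
      also have "\<dots> = f (reflection a (\<Sum>x\<in>B. real (k x) *\<^sub>R x))"
        by (simp add: linear_sum[OF lin] linear_scale[OF lin]
            linear_sum[OF linear_reflection] linear_scale[OF linear_reflection])
      also have "\<dots> = - f a" using k by (simp add: reflection_self linear_neg[OF lin] flip: k)
      finally show False using a(2) by simp
    qed
  qed
qed

text \<open>In the positive root \<open>reflection a b\<close> the coefficient of \<open>a\<close>
  is minus a Cartan integer, and it must be nonnegative.\<close>

lemma simple_obtuse:
  assumes "a \<in> B" "b \<in> B" "a \<noteq> b"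
  shows "a \<bullet> b \<le> 0"
proof -
  have bR: "b \<in> R" "a \<in> R" using assms sub by auto
  have "0 < f (reflection a b)" using simple_reflection_pos assms pos bR by auto
  then obtain k :: "'a \<Rightarrow> nat" where k: "reflection a b = (\<Sum>x\<in>B. real (k x) *\<^sub>R x)"
    using expansion root_system_reflection[OF rs] bR by (meson less_imp_le)
  define t where "t = 2 * (b \<bullet> a) / (a \<bullet> a)"
  have "(\<Sum>x\<in>B. ((if x = b then 1 else 0) - (if x = a then t else 0)) *\<^sub>R x) = b - t *\<^sub>R a"
    using assms finB
    by (simp add: scaleR_diff_left sum_subtractf if_distrib[where f = "\<lambda>u. u *\<^sub>R _"] sum.delta
        cong: if_cong)
  also have "\<dots> = (\<Sum>x\<in>B. real (k x) *\<^sub>R x)"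
    using k by (simp add: reflection_def t_def)
  finally have "(\<Sum>x\<in>B. ((if x = b then 1 else 0) - (if x = a then t else 0)) *\<^sub>R x) =
      (\<Sum>x\<in>B. real (k x) *\<^sub>R x)" .
  from coeff_unique[OF this assms(1)] have "t \<le> 0" using assms(3) by simp
  then show ?thesis
    using root_system_nonzero[OF rs bR(2)]
    by (simp add: t_def divide_le_0_iff inner_commute) (metis inner_gt_zero_iff not_le)
qed

section \<open>Words in simple reflections and the exchange property\<close>

lemma simple_acute:
  assumes "b \<in> R" "0 < f b"
  obtains a where "a \<in> B" "0 < b \<bullet> a"
proof -
  obtain k :: "'a \<Rightarrow> nat" where k: "b = (\<Sum>x\<in>B. real (k x) *\<^sub>R x)"
    using expansion[OF assms(1) less_imp_le[OF assms(2)]] by blast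
  have "0 < b \<bullet> b" using root_system_nonzero[OF rs assms(1)] by simp
  also have "b \<bullet> b = (\<Sum>x\<in>B. real (k x) * (b \<bullet> x))"
    by (subst (2) k) (simp add: inner_sum_right)
  finally obtain x where "x \<in> B" "0 < real (k x) * (b \<bullet> x)"
    by (meson not_le sum_nonpos)
  then show thesis using that by (auto simp: zero_less_mult_iff)
qed

text \<open>Reflecting \<open>b\<close> in a simple root \<open>a\<close> at an acute angle lowers
  \<open>f\<close>, and \<open>reflection b\<close> is the conjugate of the new reflection by
  \<open>reflection a\<close>. As \<open>f\<close> is real-valued, the induction counts roots of
  smaller value.\<close>

lemma reflection_word:
  assumes "b \<in> R" "0 < f b"
  shows "\<exists>l. set l \<subseteq> B \<and> reflection b = reflection_prod l"
  using assms
proof (induction b rule: measure_induct_rule[where f = "\<lambda>b. card {c \<in> R. f c < f b}"])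
  case (less b)
  show ?case
  proof (cases "b \<in> B")
    case True
    then show ?thesis by (intro exI[of _ "[b]"]) auto
  next
    case False
    obtain a where a: "a \<in> B" "0 < b \<bullet> a" using simple_acute less.prems by blast
    let ?c = "reflection a b"
    have aR: "a \<in> R" using a sub by auto
    have c: "?c \<in> R" "0 < f ?c"
      using root_system_reflection[OF rs aR less.prems(1)]
        simple_reflection_pos[OF a(1) less.prems] False a by auto
    have "0 < 2 * (b \<bullet> a) / (a \<bullet> a) * f a"
      using a pos[OF a(1)] root_system_nonzero[OF rs aR] by simp
    then have lt: "f ?c < f b"
      by (simp add: reflection_def linear_diff[OF lin] linear_scale[OF lin])
    have "card {d \<in> R. f d < f ?c} < card {d \<in> R. f d < f b}"
      by (rule psubset_card_mono) (use fin lt c in auto)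
    from less.IH[OF this c] obtain l where l: "set l \<subseteq> B" "reflection ?c = reflection_prod l" by blast
    have "reflection b x = reflection_prod (a # l @ [a]) x" for x
      using reflection_orthogonal_transformation[OF orthogonal_transformation_reflection, of a b x]
      by (simp flip: l(2))
    then show ?thesis using l a by (intro exI[of _ "a # l @ [a]"]) auto
  qed
qed

lemma reflection_group_word:
  assumes "w \<in> reflection_group R"
  obtains l where "set l \<subseteq> B" "w = reflection_prod l"
proof -
  have gen: "\<exists>l. set l \<subseteq> B \<and> reflection b = reflection_prod l" if "b \<in> R" for b
  proof (cases "0 < f b")
    case False
    then have "0 < f (- b)" using regular[OF that] by (simp add: linear_neg[OF lin])
    then show ?thesis
      using reflection_word[of "- b"] root_system_uminus[OF rs that] by (simp add: reflection_uminus)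
  qed (use reflection_word that in blast)
  have "w \<in> generate orth_group (reflection ` R)"
    using assms by (simp add: reflection_group_def)
  then have "\<exists>l. set l \<subseteq> B \<and> w = reflection_prod l"
  proof induction
    case one
    show ?case by (intro exI[of _ "[]"]) (auto simp: orth_group_def)
  next
    case (incl h)
    then show ?case using gen by auto
  next
    case (inv h)
    then obtain b where b: "b \<in> R" "h = reflection b" by auto
    then have "h \<in> carrier orth_group"
      using reflection_in_orth_group root_system_nonzero[OF rs] by blast
    moreover have "h \<otimes>\<^bsub>orth_group\<^esub> h = \<one>\<^bsub>orth_group\<^esub>"
      using b by (auto simp: orth_group_def)
    ultimately have "inv\<^bsub>orth_group\<^esub> h = h"
      using group.inv_equality[OF group_orth_group] by blast
    then show ?case using gen b by auto
  next
    case (eng h1 h2)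
    then obtain l1 l2 where "set l1 \<subseteq> B" "h1 = reflection_prod l1" "set l2 \<subseteq> B" "h2 = reflection_prod l2"
      by blast
    then show ?case by (intro exI[of _ "l1 @ l2"]) (auto simp: orth_group_def)
  qed
  then show thesis using that by blast
qed

lemma reflection_prod_root:
  assumes "set l \<subseteq> B" "b \<in> R"
  shows "reflection_prod l b \<in> R"
  using assms by (induction l) (use root_system_reflection[OF rs] sub in auto)

text \<open>Read the word from the right and follow the image of \<open>b\<close>. It first turns
  negative at some letter \<open>c\<close>, and \<open>c\<close> is the only positive root that its
  own reflection makes negative.\<close>

lemma exchange:
  assumes "set l \<subseteq> B" "b \<in> R" "0 < f b" "f (reflection_prod l b) < 0"
  shows "\<exists>x c y. l = x @ c # y \<and> reflection_prod y b = c"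
  using assms
proof (induction l)
  case (Cons c y)
  have yR: "reflection_prod y b \<in> R" using Cons.prems by (auto intro: reflection_prod_root)
  show ?case
  proof (cases "f (reflection_prod y b) < 0")
    case True
    then obtain x c' y' where "y = x @ c' # y'" "reflection_prod y' b = c'"
      using Cons by auto
    then show ?thesis by (metis append_Cons)
  next
    case False
    then have "0 < f (reflection_prod y b)" using regular[OF yR] by simp
    then have "reflection_prod y b = c"
      using simple_reflection_pos[of c, OF _ yR] Cons.prems by force
    then show ?thesis by blast
  qed
qed auto

text \<open>Descent on length: if \<open>a\<close> is the last letter, the rest of the word sends
  \<open>a\<close> to a negative root, so the exchange property removes two letters without changing
  the product.\<close>

lemma positive_preserving_word:
  assumes "set l \<subseteq> B" "\<And>b. b \<in> R \<Longrightarrow> 0 < f b \<Longrightarrow> 0 < f (reflection_prod l b)"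
  shows "reflection_prod l = id"
  using assms
proof (induction l rule: length_induct)
  case (1 l)
  show ?case
  proof (cases l rule: rev_cases)
    case (snoc m a)
    then have a: "a \<in> B" "a \<in> R" "set m \<subseteq> B" using "1.prems"(1) sub by auto
    have "0 < f (reflection_prod l a)" using "1.prems"(2)[OF a(2)] pos[OF a(1)] by simp
    moreover have "reflection_prod m (- a) = - reflection_prod m a"
      by (rule linear_neg[OF orthogonal_transformation_linear[OF orthogonal_transformation_reflection_prod]])
    ultimately have "f (reflection_prod m a) < 0"
      by (simp add: snoc reflection_self linear_neg[OF lin])
    with exchange[OF a(3,2) pos[OF a(1)]] obtain x c y
      where m: "m = x @ c # y" "reflection_prod y a = c" by blast
    \<comment> \<open>As \<open>c\<close> is the image of \<open>a\<close> under \<open>y\<close>,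
      the letter \<open>c\<close> moves through \<open>y\<close> and becomes \<open>a\<close>, which
      cancels against the last letter of \<open>l\<close>.\<close>
    have "reflection c (reflection_prod y z) = reflection_prod y (reflection a z)" for z
      using reflection_orthogonal_transformation[OF orthogonal_transformation_reflection_prod, of y a z]
      by (simp add: m(2))
    then have eq: "reflection_prod l = reflection_prod (x @ y)"
      by (auto simp: snoc m)
    have "reflection_prod (x @ y) = id"
      using "1.IH"[rule_format, of "x @ y"] "1.prems" unfolding eq by (simp add: snoc m)
    then show ?thesis using eq by simp
  qed simp
qed

end

section \<open>Passing between simple systems and regular functionals\<close>

lemma simple_roots_functional:
  assumes "root_system R" "simple_roots R B"
  obtains f where "based_root_system R B f"
proof -
  have "independent B" using assms by (simp add: simple_roots_def)
  \<comment> \<open>The value 1 on every simple root makes \<open>f\<close> the height.\<close>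
  then obtain f :: "'a \<Rightarrow> real" where "linear f" "\<forall>a\<in>B. f a = 1"
    using linear_independent_extend[of B "\<lambda>_. 1"] by blast
  then have "based_root_system R B f"
    using assms by (intro based_root_system.intro) auto
  then show thesis by (rule that)
qed

text \<open>If both Cartan integers were at least 2, \<open>a - b\<close> would have squared length
  at most 0. Hence one of them is 1, and the corresponding reflection yields \<open>a - b\<close> up
  to sign.\<close>

lemma root_diff:
  assumes rs: "root_system R" and a: "a \<in> R" and b: "b \<in> R" and "a \<noteq> b" and ab: "0 < a \<bullet> b"
  shows "a - b \<in> R"
proof -
  have nz: "a \<noteq> 0" "b \<noteq> 0" using root_system_nonzero[OF rs] a b by auto
  obtain m n :: int where m: "2 * (a \<bullet> b) / (b \<bullet> b) = of_int m" and n: "2 * (b \<bullet> a) / (a \<bullet> a) = of_int n"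
    using rs a b unfolding root_system_def by (metis Ints_cases)
  have "m > 0" "n > 0"
    using ab nz m n by (metis inner_commute inner_gt_zero_iff mult_pos_pos of_int_0_less_iff zero_less_divide_iff zero_less_numeral)+
  have "m = 1 \<or> n = 1"
  proof (rule ccontr)
    assume "\<not> (m = 1 \<or> n = 1)"
    then have "m \<ge> 2" "n \<ge> 2" using \<open>m > 0\<close> \<open>n > 0\<close> by auto
    then have "of_int m \<ge> (2::real)" "of_int n \<ge> (2::real)" by simp_all
    then have le: "a \<bullet> b \<ge> b \<bullet> b" "a \<bullet> b \<ge> a \<bullet> a"
      using nz unfolding m[symmetric] n[symmetric] by (simp_all add: field_simps inner_commute)
    have "(a - b) \<bullet> (a - b) = a \<bullet> a - 2 * (a \<bullet> b) + b \<bullet> b"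
      by (simp add: inner_diff_left inner_diff_right inner_commute)
    also have "\<dots> \<le> 0" using le by simp
    finally show False using \<open>a \<noteq> b\<close>
      by (metis eq_iff_diff_eq_0 inner_gt_zero_iff not_le)
  qed
  then show ?thesis
  proof
    assume "m = 1"
    then have "reflection b a = a - b" unfolding reflection_def m by simp
    then show ?thesis using root_system_reflection[OF rs b a] by simp
  next
    assume "n = 1"
    then have "- reflection a b = a - b" unfolding reflection_def n by simp
    then show ?thesis using root_system_uminus[OF rs root_system_reflection[OF rs a b]] by simp
  qed
qed

text \<open>A linear relation splits into two nonnegative expansions of one vector \<open>y\<close>.
  Obtuseness gives \<open>y \<bullet> y \<le> 0\<close>, so \<open>y = 0\<close>, and positivity of
  \<open>f\<close> kills every coefficient.\<close>

lemma independent_obtuse: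
  fixes B :: "'a::euclidean_space set" and f :: "'a \<Rightarrow> real"
  assumes "finite B" "linear f" "\<And>a. a \<in> B \<Longrightarrow> 0 < f a"
    and obtuse: "\<And>a b. a \<in> B \<Longrightarrow> b \<in> B \<Longrightarrow> a \<noteq> b \<Longrightarrow> a \<bullet> b \<le> 0"
  shows "independent B"
proof (rule independent_if_scalars_zero[OF assms(1)])
  fix u x assume u: "(\<Sum>x\<in>B. u x *\<^sub>R x) = 0" and x: "x \<in> B"
  define p q where "p x = max 0 (u x)" and "q x = max 0 (- u x)" for x
  define y where "y = (\<Sum>x\<in>B. p x *\<^sub>R x)"
  have pq: "u x = p x - q x" "p x * q x = 0" "0 \<le> p x" "0 \<le> q x" for x
    by (auto simp: p_def q_def max_def)
  have y2: "y = (\<Sum>x\<in>B. q x *\<^sub>R x)"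
    using u by (simp add: y_def pq(1) scaleR_diff_left sum_subtractf)
  \<comment> \<open>One factor is expanded by \<open>p\<close>, the other by \<open>q\<close>; their
    disjoint supports remove the diagonal terms.\<close>
  have "y \<bullet> y = (\<Sum>x\<in>B. \<Sum>z\<in>B. p x * (q z * (x \<bullet> z)))"
    by (subst (2) y2, subst y_def, simp add: inner_sum_left)
      (simp add: inner_sum_right sum_distrib_left mult_ac)
  also have "\<dots> \<le> 0"
  proof (intro sum_nonpos)
    fix x z assume xz: "x \<in> B" "z \<in> B"
    show "p x * (q z * (x \<bullet> z)) \<le> 0"
    proof (cases "x = z")
      case True
      then have "p x * (q z * (x \<bullet> z)) = (p x * q x) * (x \<bullet> z)" by simp
      also have "\<dots> = 0" unfolding pq(2) by simp
      finally show ?thesis by (rule eq_refl)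
    next
      case False
      then show ?thesis using obtuse[OF xz] pq by (simp add: mult_nonneg_nonpos)
    qed
  qed
  finally have "y = 0" by (metis inner_gt_zero_iff not_le)
  then have f0: "(\<Sum>x\<in>B. p x * f x) = 0" "(\<Sum>x\<in>B. q x * f x) = 0"
    using arg_cong[OF y_def, of f] arg_cong[OF y2, of f] assms(2)
    by (simp_all add: linear_sum linear_scale linear_0)
  have nonneg: "0 \<le> p x * f x" "0 \<le> q x * f x" if "x \<in> B" for x
    using pq(3,4)[of x] assms(3)[OF that] by simp_all
  have "p x * f x = 0"
    using sum_nonneg_eq_0_iff[OF assms(1), of "\<lambda>x. p x * f x"] nonneg(1) f0(1) x by simp
  moreover have "q x * f x = 0"
    using sum_nonneg_eq_0_iff[OF assms(1), of "\<lambda>x. q x * f x"] nonneg(2) f0(2) x by simp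
  ultimately have "p x = 0" "q x = 0" using assms(3)[OF x] by simp_all
  then show "u x = 0" using pq(1)[of x] by simp
qed

text \<open>The base consists of the positive roots that are not sums of two positive roots. Two
  distinct ones at an acute angle would differ by a root, which would decompose one of them; all
  other positive roots decompose inductively.\<close>

lemma simple_roots_exist:
  fixes R :: "'a::euclidean_space set" and f :: "'a \<Rightarrow> real"
  assumes rs: "root_system R" and lin: "linear f" and reg: "\<And>b. b \<in> R \<Longrightarrow> f b \<noteq> 0"
  obtains B where "based_root_system R B f"
proof -
  define B where "B = {a \<in> R. 0 < f a \<and> \<not> (\<exists>b\<in>R. \<exists>c\<in>R. 0 < f b \<and> 0 < f c \<and> a = b + c)}"
  have fin: "finite R" "finite B" using rs by (auto simp: root_system_def B_def)
  have obtuse: "a \<bullet> b \<le> 0" if ab: "a \<in> B" "b \<in> B" "a \<noteq> b" for a b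
  proof (rule ccontr)
    assume "\<not> a \<bullet> b \<le> 0"
    then have d: "a - b \<in> R" using root_diff[OF rs] ab by (auto simp: B_def)
    then have d': "b - a \<in> R" using root_system_uminus[OF rs] by fastforce
    have "0 < f (a - b) \<or> 0 < f (b - a)"
      using reg[OF d] linear_diff[OF lin, of a b] linear_diff[OF lin, of b a] by linarith
    then consider "0 < f (a - b)" | "0 < f (b - a)" by blast
    then show False
    proof cases
      case 1
      have "a = (a - b) + b" by simp
      then show False using 1 d ab unfolding B_def by blast
    next
      case 2
      have "b = (b - a) + a" by simp
      then show False using 2 d' ab unfolding B_def by blast
    qed
  qed
  have expand: "\<exists>k :: 'a \<Rightarrow> nat. b = (\<Sum>a\<in>B. real (k a) *\<^sub>R a)" if "b \<in> R" "0 < f b" for b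
    using that
  proof (induction b rule: measure_induct_rule[where f = "\<lambda>b. card {c \<in> R. f c < f b}"])
    case (less b)
    show ?case
    proof (cases "b \<in> B")
      case True
      then have "b = (\<Sum>a\<in>B. real (if a = b then 1 else 0) *\<^sub>R a)"
        using fin by (simp add: if_distrib[where f = "\<lambda>u. u *\<^sub>R _"] if_distrib[where f = real] cong: if_cong)
      then show ?thesis by (intro exI[of _ "\<lambda>a. if a = b then 1 else 0"])
    next
      case False
      then obtain c d where cd: "c \<in> R" "d \<in> R" "0 < f c" "0 < f d" "b = c + d"
        using less.prems unfolding B_def by blast
      then have lt: "f c < f b" "f d < f b" by (simp_all add: linear_add[OF lin])
      have "card {x \<in> R. f x < f c} < card {x \<in> R. f x < f b}"
        by (rule psubset_card_mono) (use fin lt cd in auto)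
      from less.IH[OF this cd(1,3)]
      obtain k :: "'a \<Rightarrow> nat" where k: "c = (\<Sum>a\<in>B. real (k a) *\<^sub>R a)" by blast
      have "card {x \<in> R. f x < f d} < card {x \<in> R. f x < f b}"
        by (rule psubset_card_mono) (use fin lt cd in auto)
      from less.IH[OF this cd(2,4)]
      obtain m :: "'a \<Rightarrow> nat" where m: "d = (\<Sum>a\<in>B. real (m a) *\<^sub>R a)" by blast
      then have "b = (\<Sum>a\<in>B. real (k a + m a) *\<^sub>R a)"
        using cd(5) by (simp add: scaleR_add_left sum.distrib flip: k m)
      then show ?thesis by (intro exI[of _ "\<lambda>a. k a + m a"])
    qed
  qed
  have "\<exists>k :: 'a \<Rightarrow> nat. b = (\<Sum>a\<in>B. real (k a) *\<^sub>R a) \<or> b = - (\<Sum>a\<in>B. real (k a) *\<^sub>R a)"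
    if bR: "b \<in> R" for b
  proof (cases "0 < f b")
    case False
    then have "0 < f (- b)" using reg[OF bR] by (simp add: linear_neg[OF lin])
    then obtain k :: "'a \<Rightarrow> nat" where "- b = (\<Sum>a\<in>B. real (k a) *\<^sub>R a)"
      using expand[OF root_system_uminus[OF rs bR]] by blast
    then have "b = - (\<Sum>a\<in>B. real (k a) *\<^sub>R a)" by (metis minus_minus)
    then show ?thesis by blast
  qed (use expand[OF bR] in blast)
  moreover have "independent B"
    by (rule independent_obtuse[OF fin(2) lin _ obtuse]) (auto simp: B_def)
  ultimately have "simple_roots R B"
    unfolding simple_roots_def by (auto simp: B_def)
  then have "based_root_system R B f"
    using rs lin by (intro based_root_system.intro) (auto simp: B_def)
  then show thesis by (rule that)
qed

text \<open>A base adapted to \<open>f\<close> reduces this to words. It stays out of the statement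
  so that a functional inherited from a larger root system can be used.\<close>

lemma positive_preserving_id:
  fixes R :: "'a::euclidean_space set" and f :: "'a \<Rightarrow> real"
  assumes "root_system R" "linear f" "\<And>b. b \<in> R \<Longrightarrow> f b \<noteq> 0"
    and "w \<in> reflection_group R" and "\<And>b. b \<in> R \<Longrightarrow> 0 < f b \<Longrightarrow> 0 < f (w b)"
  shows "w = id"
proof -
  obtain B where "based_root_system R B f" using simple_roots_exist assms(1-3) by blast
  then interpret based_root_system R B f .
  obtain l where "set l \<subseteq> B" "w = reflection_prod l"
    using reflection_group_word assms(4) by blast
  then show ?thesis using positive_preserving_word assms(5) by blast
qed

section \<open>Conjugacy of simple systems and of Coxeter elements\<close>

lemma simple_roots_image:
  fixes R :: "'a::euclidean_space set"
  assumes "simple_roots R B" "orthogonal_transformation w" "w ` R = R"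
  shows "simple_roots R (w ` B)"
proof -
  have lin: "linear w" and inj: "inj w"
    using assms(2) orthogonal_transformation_linear orthogonal_transformation_inj by auto
  have injB: "inj_on w B" using inj by (rule inj_on_subset) simp
  have "independent (w ` B)"
    using linear_independent_injective_image[OF lin, of B] assms(1) inj_on_subset[OF inj]
    by (simp add: simple_roots_def)
  moreover have "w ` B \<subseteq> R" using assms by (auto simp: simple_roots_def)
  moreover have "\<exists>k :: 'a \<Rightarrow> nat. b = (\<Sum>a\<in>w ` B. real (k a) *\<^sub>R a) \<or> b = - (\<Sum>a\<in>w ` B. real (k a) *\<^sub>R a)"
    if bR: "b \<in> R" for b
  proof -
    have "b \<in> w ` R" using assms(3) bR by simp
    then obtain c where c: "c \<in> R" "b = w c" by (rule imageE)
    obtain k :: "'a \<Rightarrow> nat" where k: "c = (\<Sum>a\<in>B. real (k a) *\<^sub>R a) \<or> c = - (\<Sum>a\<in>B. real (k a) *\<^sub>R a)"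
      using assms(1) c(1) unfolding simple_roots_def by blast
    define m where "m = k \<circ> inv_into UNIV w"
    have "w (\<Sum>a\<in>B. real (k a) *\<^sub>R a) = (\<Sum>a\<in>B. real (m (w a)) *\<^sub>R w a)"
      by (simp add: linear_sum[OF lin] linear_scale[OF lin] m_def inj)
    then have w: "w (\<Sum>a\<in>B. real (k a) *\<^sub>R a) = (\<Sum>a\<in>w ` B. real (m a) *\<^sub>R a)"
      by (simp add: sum.reindex[OF injB])
    have "b = (\<Sum>a\<in>w ` B. real (m a) *\<^sub>R a) \<or> b = - (\<Sum>a\<in>w ` B. real (m a) *\<^sub>R a)"
      using k unfolding c(2) w[symmetric] linear_neg[OF lin, symmetric] by (elim disjE) simp_all
    then show ?thesis by blast
  qed
  ultimately show ?thesis unfolding simple_roots_def by blast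
qed

text \<open>A walk through the chambers: while some simple root \<open>a\<close> of \<open>B\<close>
  is negative for \<open>g\<close>, reflecting \<open>B'\<close> in \<open>a\<close> reduces the
  number of \<open>f\<close>-positive roots that are \<open>g\<close>-negative.\<close>

lemma simple_systems_conjugate:
  fixes R :: "'a::euclidean_space set"
  assumes rs: "root_system R" and B: "simple_roots R B" and B': "simple_roots R B'"
  obtains w where "orthogonal_transformation w" "B' = w ` B"
proof -
  obtain f where "based_root_system R B f" using simple_roots_functional rs B by blast
  then interpret based_root_system R B f .
  have "\<exists>w. orthogonal_transformation w \<and> B' = w ` B" if "based_root_system R B' g" for B' g
    using that
  proof (induction "card {b \<in> R. 0 < f b \<and> g b < 0}" arbitrary: B' g rule: less_induct)
    case less
    interpret B': based_root_system R B' g by (rule less.prems)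
    show ?case
    proof (cases "\<exists>a\<in>B. g a < 0")
      case False
      \<comment> \<open>With no such simple root, nonnegative expansions make \<open>f\<close> and
        \<open>g\<close> agree in sign on \<open>R\<close>, and the sign description of bases gives
        \<open>B' = B\<close>.\<close>
      have gpos: "0 < g b" if b: "b \<in> R" "0 < f b" for b
      proof -
        obtain k :: "'a \<Rightarrow> nat" where k: "b = (\<Sum>a\<in>B. real (k a) *\<^sub>R a)"
          using expansion[OF b(1) less_imp_le[OF b(2)]] by blast
        have "g b = (\<Sum>a\<in>B. real (k a) * g a)"
          by (subst k) (simp add: linear_sum[OF B'.lin] linear_scale[OF B'.lin])
        also have "\<dots> \<ge> 0" using False by (intro sum_nonneg mult_nonneg_nonneg) force+
        finally show ?thesis using B'.regular[OF b(1)] by linarith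
      qed
      have "0 < g b \<longleftrightarrow> 0 < f b" if "b \<in> R" for b
      proof
        assume "0 < g b"
        show "0 < f b"
        proof (rule ccontr)
          assume "\<not> 0 < f b"
          then have "0 < f (- b)" using regular[OF that] by (simp add: linear_neg[OF lin])
          then have "0 < g (- b)" using gpos root_system_uminus[OF rs that] by blast
          then show False using \<open>0 < g b\<close> by (simp add: linear_neg[OF B'.lin])
        qed
      qed (use gpos that in blast)
      then have "B' = {a \<in> R. 0 < f a \<and> (\<forall>b\<in>R. 0 < f b \<longrightarrow> b \<noteq> a \<longrightarrow> 0 < f (reflection a b))}"
        using root_system_reflection[OF rs] by (subst B'.simple_eq) auto
      also have "\<dots> = B" by (rule simple_eq[symmetric])
      finally show ?thesis by (intro exI[of _ "\<lambda>x. x"]) auto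
    next
      case True
      then obtain a where a: "a \<in> B" "g a < 0" by blast
      then have aR: "a \<in> R" using sub by blast
      have ot: "orthogonal_transformation (reflection a)"
        by (rule orthogonal_transformation_reflection)
      have "based_root_system R (reflection a ` B') (g \<circ> reflection a)"
      proof (rule based_root_system.intro)
        show "simple_roots R (reflection a ` B')"
          using simple_roots_image[OF B'.simple ot] rs aR by (auto simp: root_system_def)
        show "linear (g \<circ> reflection a)"
          by (rule linear_compose[OF linear_reflection B'.lin])
      qed (use rs B'.pos in auto)
      moreover
      have "card {b \<in> R. 0 < f b \<and> (g \<circ> reflection a) b < 0} < card {b \<in> R. 0 < f b \<and> g b < 0}"
        (is "card ?S < card ?T")
      proof -
        \<comment> \<open>The reflection keeps positive roots other than \<open>a\<close> positive;
          \<open>a\<close> itself lies in \<open>?T\<close> but not in the image.\<close>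
        have "reflection a ` ?S \<subseteq> ?T - {a}"
        proof
          fix y assume "y \<in> reflection a ` ?S"
          then obtain b where b: "b \<in> R" "0 < f b" "g (reflection a b) < 0" "y = reflection a b"
            by auto
          have "b \<noteq> a" using b(3) a by (auto simp: reflection_self linear_neg[OF B'.lin])
          then have "0 < f y" using simple_reflection_pos[OF a(1) b(1,2)] b by simp
          moreover have "y \<noteq> a"
          proof
            assume "y = a"
            then have "b = - a" using b(4) by (metis reflection_reflection reflection_self)
            then show False using b(2) pos[OF a(1)] by (simp add: linear_neg[OF lin])
          qed
          ultimately show "y \<in> ?T - {a}"
            using b root_system_reflection[OF rs aR b(1)] by auto
        qed
        moreover have "inj_on (reflection a) ?S"
          by (rule inj_onI) (metis reflection_reflection)
        ultimately have "card ?S \<le> card (?T - {a})"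
          using card_inj_on_le[of "reflection a" ?S "?T - {a}"] fin by simp
        also have "\<dots> < card ?T"
          by (rule card_Diff1_less) (use fin a aR pos in auto)
        finally show ?thesis .
      qed
      ultimately obtain w where w: "orthogonal_transformation w" "reflection a ` B' = w ` B"
        using less.hyps[of "g \<circ> reflection a"] by blast
      have "B' = reflection a ` reflection a ` B'" by (simp add: image_image)
      then have "B' = (reflection a \<circ> w) ` B" using w by (simp add: image_comp)
      then show ?thesis using orthogonal_transformation_compose[OF ot w(1)] by blast
    qed
  qed
  moreover obtain g where "based_root_system R B' g" using simple_roots_functional[OF rs B'] by blast
  ultimately obtain w where "orthogonal_transformation w" "B' = w ` B" by blast
  then show thesis by (rule that)
qed

section \<open>Orderings of a word up to conjugacy of its product\<close>

inductive word_equiv :: "'a::euclidean_space list \<Rightarrow> 'a list \<Rightarrow> bool" where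
  refl: "word_equiv l l"
| sym: "word_equiv l m \<Longrightarrow> word_equiv m l"
| trans: "word_equiv l m \<Longrightarrow> word_equiv m n \<Longrightarrow> word_equiv l n"
| swap: "a \<bullet> b = 0 \<Longrightarrow> word_equiv (x @ a # b # y) (x @ b # a # y)"
| rotate: "word_equiv (a # x) (x @ [a])"

lemmas [trans] = word_equiv.trans

lemma word_equiv_mset: "word_equiv l m \<Longrightarrow> mset m = mset l"
  by (induction rule: word_equiv.induct) auto

text \<open>A swap of orthogonal letters leaves the product unchanged, and a rotation conjugates it
  by the moved reflection.\<close>

lemma word_equiv_conjugate:
  "word_equiv l m \<Longrightarrow>
    \<exists>w. orthogonal_transformation w \<and> reflection_prod m \<circ> w = w \<circ> reflection_prod l"
proof (induction rule: word_equiv.induct)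
  case (refl l)
  show ?case by (intro exI[of _ "\<lambda>x. x"]) auto
next
  case (sym l m)
  then obtain w where w: "orthogonal_transformation w" "reflection_prod m \<circ> w = w \<circ> reflection_prod l"
    by blast
  let ?v = "inv_into UNIV w"
  have wv: "w (?v x) = x" "?v (w x) = x" for x
    using orthogonal_transformation_bij[OF w(1)] by (auto simp: bij_def surj_f_inv_f)
  have "reflection_prod l (?v x) = ?v (reflection_prod m x)" for x
    using fun_cong[OF w(2), of "?v x"] by (simp add: wv)
  then show ?case
    by (intro exI[of _ ?v]) (auto simp: orthogonal_transformation_inv[OF w(1)])
next
  case (trans l m n)
  then obtain v w where vw: "orthogonal_transformation v" "reflection_prod m \<circ> v = v \<circ> reflection_prod l"
     "orthogonal_transformation w" "reflection_prod n \<circ> w = w \<circ> reflection_prod m" by blast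
  then have "reflection_prod n \<circ> (w \<circ> v) = (w \<circ> v) \<circ> reflection_prod l"
    by (metis comp_assoc)
  then show ?case using orthogonal_transformation_compose[OF vw(3,1)] by blast
next
  case (swap a b x y)
  then have "reflection_prod (x @ b # a # y) = reflection_prod (x @ a # b # y)"
    by (simp add: fun_eq_iff reflection_commute[OF swap])
  then show ?case by (intro exI[of _ "\<lambda>x. x"]) auto
next
  case (rotate a x)
  show ?case
    by (intro exI[of _ "reflection a"]) (auto simp: orthogonal_transformation_reflection)
qed

lemma word_equiv_move:
  "(\<And>b. b \<in> set x \<Longrightarrow> a \<bullet> b = 0) \<Longrightarrow> word_equiv (p @ a # x @ q) (p @ x @ a # q)"
proof (induction x arbitrary: p)
  case (Cons b x)
  have "word_equiv (p @ a # b # x @ q) (p @ b # a # x @ q)"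
    using Cons.prems by (intro word_equiv.swap) auto
  also have "word_equiv (p @ b # a # x @ q) (p @ b # x @ a # q)"
    using Cons.IH[of "p @ [b]"] Cons.prems by auto
  finally show ?case by simp
qed (simp add: word_equiv.refl)

text \<open>The delicate case is a rotation of \<open>l\<close>. If \<open>a\<close> is orthogonal
  to the rotated letter, that letter passes \<open>a\<close>; otherwise it is the only neighbour of
  \<open>a\<close>, so \<open>a\<close> commutes with all other letters and can be carried around
  the back.\<close>

lemma word_equiv_Cons:
  assumes "word_equiv l m" "distinct l"
    and "\<And>b c. b \<in> set l \<Longrightarrow> c \<in> set l \<Longrightarrow> a \<bullet> b \<noteq> 0 \<Longrightarrow> a \<bullet> c \<noteq> 0 \<Longrightarrow> b = c"
  shows "word_equiv (a # l) (a # m)"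
  using assms
proof (induction rule: word_equiv.induct)
  case (sym l m)
  then have "set l = set m" "distinct l"
    using word_equiv_mset[OF sym.hyps] by (metis mset_eq_setD, metis mset_eq_imp_distinct_iff)
  with sym show ?case by (auto intro: word_equiv.sym)
next
  case (trans l m n)
  have eq: "set m = set l" and d: "distinct m"
    using word_equiv_mset[OF trans.hyps(1)] trans.prems(1)
    by (metis mset_eq_setD, metis mset_eq_imp_distinct_iff)
  have "word_equiv (a # l) (a # m)" by (rule trans.IH(1)[OF trans.prems])
  also have "word_equiv (a # m) (a # n)"
    by (rule trans.IH(2)[OF d trans.prems(2)]) (simp_all add: eq)
  finally show ?case .
next
  case (swap b c x y)
  show ?case using word_equiv.swap[OF swap.hyps, of "a # x" y] by simp
next
  case (rotate z x)
  show ?case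
  proof (cases "a \<bullet> z = 0")
    case True
    then have "word_equiv (a # z # x) (z # a # x)" using word_equiv.swap[of a z "[]" x] by simp
    also have "word_equiv (z # a # x) (a # x @ [z])" using word_equiv.rotate[of z "a # x"] by simp
    finally show ?thesis .
  next
    case False
    then have *: "a \<bullet> b = 0" if "b \<in> set x" for b
      using rotate.prems(1) rotate.prems(2)[of z b] that by auto
    have "word_equiv (a # z # x) (z # x @ [a])" using word_equiv.rotate[of a "z # x"] by simp
    also have "word_equiv (z # x @ [a]) (z # a # x)"
      using word_equiv.sym[OF word_equiv_move[OF *, of x "[z]" "[]"]] by simp
    also have "word_equiv (z # a # x) (a # x @ [z])" using word_equiv.rotate[of z "a # x"] by simp
    finally show ?thesis .
  qed
qed (rule word_equiv.refl)

text \<open>Any neighbour of \<open>a\<close> lies on one side only, so \<open>a\<close> slides away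
  on the other side and reaches the front directly or by a rotation.\<close>

lemma word_equiv_leaf_front:
  assumes "distinct (x @ a # y)"
    and "\<And>b c. b \<in> set (x @ y) \<Longrightarrow> c \<in> set (x @ y) \<Longrightarrow> a \<bullet> b \<noteq> 0 \<Longrightarrow> a \<bullet> c \<noteq> 0 \<Longrightarrow> b = c"
  shows "word_equiv (x @ a # y) (a # x @ y)"
proof (cases "\<forall>b\<in>set y. a \<bullet> b = 0")
  case True
  then have "word_equiv (x @ a # y) (x @ y @ [a])"
    using word_equiv_move[of y a x "[]"] by simp
  also have "word_equiv (x @ y @ [a]) (a # x @ y)"
    using word_equiv.sym[OF word_equiv.rotate[of a "x @ y"]] by simp
  finally show ?thesis .
next
  case False
  then obtain d where d: "d \<in> set y" "a \<bullet> d \<noteq> 0" by blast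
  have "a \<bullet> b = 0" if "b \<in> set x" for b
    using assms(2)[of b d] d that assms(1) by auto
  then show ?thesis using word_equiv.sym[OF word_equiv_move[of x a "[]" y]] by simp
qed

text \<open>The hypothesis says that the graph joining non-orthogonal vectors is a forest: every non-empty
  subset has a vertex of degree at most one.\<close>

lemma forest_word_equiv:
  assumes leaf: "\<And>T. T \<subseteq> S \<Longrightarrow> T \<noteq> {} \<Longrightarrow>
      \<exists>a\<in>T. \<forall>b\<in>T - {a}. \<forall>c\<in>T - {a}. a \<bullet> b \<noteq> 0 \<longrightarrow> a \<bullet> c \<noteq> 0 \<longrightarrow> b = c"
    and "distinct l" "distinct m" "set l = T" "set m = T" "T \<subseteq> S"
  shows "word_equiv l m"
  using assms(2-)
proof (induction l arbitrary: m T rule: length_induct)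
  case (1 l)
  show ?case
  proof (cases "T = {}")
    case True
    then show ?thesis using "1.prems" by (auto intro: word_equiv.refl)
  next
    case False
    then obtain a where a: "a \<in> T" and
      lf: "\<And>b c. b \<in> T - {a} \<Longrightarrow> c \<in> T - {a} \<Longrightarrow> a \<bullet> b \<noteq> 0 \<Longrightarrow> a \<bullet> c \<noteq> 0 \<Longrightarrow> b = c"
      using leaf "1.prems" by meson
    obtain x y where l: "l = x @ a # y" using a "1.prems" by (metis split_list)
    obtain x' y' where m: "m = x' @ a # y'" using a "1.prems" by (metis split_list)
    have xy: "set (x @ y) = T - {a}" "set (x' @ y') = T - {a}" "distinct (x @ y)" "distinct (x' @ y')"
      using "1.prems" by (auto simp: l m)
    have lf1: "\<And>b c. b \<in> set (x @ y) \<Longrightarrow> c \<in> set (x @ y) \<Longrightarrow> a \<bullet> b \<noteq> 0 \<Longrightarrow> a \<bullet> c \<noteq> 0 \<Longrightarrow> b = c"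
      unfolding xy(1) by (rule lf)
    have lf2: "\<And>b c. b \<in> set (x' @ y') \<Longrightarrow> c \<in> set (x' @ y') \<Longrightarrow> a \<bullet> b \<noteq> 0 \<Longrightarrow> a \<bullet> c \<noteq> 0 \<Longrightarrow> b = c"
      unfolding xy(2) by (rule lf)
    \<comment> \<open>The leaf \<open>a\<close> goes to the front of both words; the remainders are
      equivalent by induction, and \<open>a\<close> can be prefixed because it has at most one
      neighbour.\<close>
    have "word_equiv l (a # x @ y)"
      unfolding l by (rule word_equiv_leaf_front[OF _ lf1]) (use "1.prems"(1) l in auto)
    also have "word_equiv (x @ y) (x' @ y')"
      using "1.IH"[rule_format, of "x @ y" "x' @ y'" "T - {a}"] xy "1.prems"(5) by (auto simp: l)
    then have "word_equiv (a # x @ y) (a # x' @ y')"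
      by (rule word_equiv_Cons[OF _ xy(3) lf1])
    also have "word_equiv (a # x' @ y') m"
      unfolding m
      by (rule word_equiv.sym[OF word_equiv_leaf_front[OF _ lf2]]) (use "1.prems"(2) m in auto)
    finally show ?thesis .
  qed
qed

context based_root_system
begin

text \<open>If every vertex of a subset had two neighbours, the sum of the normalised simple roots in that
  subset would have non-positive square length.\<close>

lemma simple_leaf:
  assumes "T \<subseteq> B" "T \<noteq> {}"
  shows "\<exists>a\<in>T. \<forall>b\<in>T - {a}. \<forall>c\<in>T - {a}. a \<bullet> b \<noteq> 0 \<longrightarrow> a \<bullet> c \<noteq> 0 \<longrightarrow> b = c"
proof -
  have fT: "finite T" using assms finB finite_subset by blast
  define e where "e a = a /\<^sub>R norm a" for a :: 'a
  have nz: "a \<noteq> 0" if "a \<in> T" for a using that assms sub root_system_nonzero[OF rs] by blast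
  have ee: "e a \<bullet> e a = 1" if "a \<in> T" for a
    using nz[OF that] by (simp add: e_def dot_square_norm power2_eq_square)
  have le0: "e a \<bullet> e b \<le> 0" if "a \<in> T" "b \<in> T" "a \<noteq> b" for a b
    using simple_obtuse[of a b] that assms
    by (auto simp: e_def intro!: mult_nonneg_nonpos)
  \<comment> \<open>Four times the squared cosine is a product of two Cartan integers, hence a
    positive integer, and the cosine is negative.\<close>
  have half: "e a \<bullet> e b \<le> - 1 / 2" if ab: "a \<in> T" "b \<in> T" "a \<noteq> b" "a \<bullet> b \<noteq> 0" for a b
  proof -
    have R: "a \<in> R" "b \<in> R" using ab assms sub by auto
    obtain m n :: int where m: "2 * (a \<bullet> b) / (b \<bullet> b) = of_int m" and n: "2 * (b \<bullet> a) / (a \<bullet> a) = of_int n"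
      using rs R unfolding root_system_def by (metis Ints_cases)
    have mn: "4 * (e a \<bullet> e b)\<^sup>2 = of_int (m * n)"
      unfolding of_int_mult m[symmetric] n[symmetric]
      by (simp add: e_def dot_square_norm inner_commute power_mult_distrib power2_eq_square field_simps)
    have "e a \<bullet> e b \<noteq> 0" using ab nz by (auto simp: e_def)
    then have "0 < 4 * (e a \<bullet> e b)\<^sup>2" by simp
    then have "0 < m * n" unfolding mn by (simp only: of_int_0_less_iff)
    then have "1 \<le> m * n" by simp
    then have "(1::real) \<le> of_int (m * n)" by (metis of_int_1_le_iff)
    then have "1 \<le> 4 * (e a \<bullet> e b)\<^sup>2" using mn by simp
    then have "(1/2)\<^sup>2 \<le> (- (e a \<bullet> e b))\<^sup>2" by (simp add: power2_eq_square)
    then have "1/2 \<le> - (e a \<bullet> e b)"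
      by (rule power2_le_imp_le) (use le0[OF ab(1-3)] in simp)
    then show ?thesis by simp
  qed
  define s where "s = (\<Sum>a\<in>T. e a)"
  have "s \<noteq> 0"
  proof
    assume "s = 0"
    then have "(\<Sum>a\<in>T. inverse (norm a) *\<^sub>R a) = 0" by (simp add: s_def e_def)
    from independentD[OF indep fT assms(1) this] show False using assms(2) nz by auto
  qed
  then have "0 < s \<bullet> s" by simp
  also have "s \<bullet> s = (\<Sum>a\<in>T. \<Sum>b\<in>T. e a \<bullet> e b)"
    unfolding s_def inner_sum_left by (simp only: inner_sum_right)
  \<comment> \<open>Some row sum of the Gram matrix is positive. Its diagonal entry is 1, and two
    neighbours would already contribute at most -1.\<close>
  finally obtain a where a: "a \<in> T" "0 < (\<Sum>b\<in>T. e a \<bullet> e b)"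
    by (meson not_le sum_nonpos)
  have "b = c" if bc: "b \<in> T - {a}" "c \<in> T - {a}" "a \<bullet> b \<noteq> 0" "a \<bullet> c \<noteq> 0" for b c
  proof (rule ccontr)
    assume "b \<noteq> c"
    have "(\<Sum>d\<in>T. e a \<bullet> e d) = (\<Sum>d\<in>T - {a, b, c}. e a \<bullet> e d) + (\<Sum>d\<in>{a, b, c}. e a \<bullet> e d)"
      using bc a fT by (intro sum.subset_diff) auto
    also have "(\<Sum>d\<in>T - {a, b, c}. e a \<bullet> e d) \<le> 0"
      using le0 a by (intro sum_nonpos) auto
    also have "(\<Sum>d\<in>{a, b, c}. e a \<bullet> e d) = 1 + (e a \<bullet> e b + e a \<bullet> e c)"
      using bc \<open>b \<noteq> c\<close> ee a by auto
    finally show False using half[of a b] half[of a c] bc a by auto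
  qed
  then show ?thesis using a by blast
qed

end

text \<open>Justifies the definite description: bases are conjugate, and over a fixed base the
  forest property makes the products of all orderings conjugate.\<close>

lemma coxeter_number_eq_ord:
  fixes R :: "'a::euclidean_space set"
  assumes rs: "root_system R" and B: "simple_roots R B" and c: "coxeter_element B c"
  shows "coxeter_number R = group.ord orth_group c"
proof -
  obtain l where l: "distinct l" "set l = B" "c = reflection_prod l"
    using c by (auto simp: coxeter_element_iff)
  have "group.ord orth_group c' = group.ord orth_group c"
    if B': "simple_roots R B'" and c': "coxeter_element B' c'" for B' c'
  proof -
    obtain m where m: "distinct m" "set m = B'" "c' = reflection_prod m"
      using c' by (auto simp: coxeter_element_iff)
    obtain w where w: "orthogonal_transformation w" "B' = w ` B"
      using simple_systems_conjugate rs B B' by blast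
    obtain f where "based_root_system R B' f" using simple_roots_functional rs B' by blast
    then interpret based_root_system R B' f .
    have "inj_on w B" using orthogonal_transformation_inj[OF w(1)] inj_on_subset by blast
    \<comment> \<open>Both words are orderings of the same base \<open>B'\<close>.\<close>
    then have "word_equiv (map w l) m"
      using l m w by (intro forest_word_equiv[OF simple_leaf _ m(1)]) (auto simp: distinct_map)
    then obtain v where v: "orthogonal_transformation v" "c' \<circ> v = v \<circ> reflection_prod (map w l)"
      using word_equiv_conjugate m by blast
    have "reflection_prod (map w l) \<circ> w = w \<circ> c"
      using reflection_prod_map[OF w(1)] l by auto
    then have "c' \<circ> (v \<circ> w) = (v \<circ> w) \<circ> c" using v(2) by (metis comp_assoc)
    then show ?thesis
      using orthogonal_transformation_compose[OF v(1) w(1)] l m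
      by (intro orth_group_ord_conj[of _ _ "v \<circ> w"])
        (auto simp: orthogonal_transformation_reflection_prod)
  qed
  then show ?thesis
    unfolding coxeter_number_def using B c by (intro the_equality) blast+
qed

section \<open>Long reflections and short Coxeter elements\<close>

lemma int_spanI: "(\<Sum>a\<in>S. of_int (k a) *\<^sub>R a) \<in> int_span S"
  by (auto simp: int_span_def)

lemma int_spanE:
  assumes "x \<in> int_span S"
  obtains k where "x = (\<Sum>a\<in>S. of_int (k a) *\<^sub>R a)"
  using assms by (auto simp: int_span_def)

section \<open>Reflection groups and elements normalising them\<close>

lemma reflection_group_id: "id \<in> reflection_group R"
  using generate.one[of orth_group "reflection ` R"] by (simp add: reflection_group_def orth_group_def)

lemma reflection_group_comp:
  "v \<in> reflection_group R \<Longrightarrow> w \<in> reflection_group R \<Longrightarrow> v \<circ> w \<in> reflection_group R"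
  using generate.eng[of v orth_group "reflection ` R" w] by (simp add: reflection_group_def orth_group_def)

lemma reflection_mem_group: "a \<in> R \<Longrightarrow> reflection a \<in> reflection_group R"
  by (auto simp: reflection_group_def intro: generate.incl)

lemma reflection_group_inverse:
  assumes "0 \<notin> R" "w \<in> reflection_group R"
  obtains v where "v \<in> reflection_group R" "v \<circ> w = id"
proof -
  have sub: "reflection ` R \<subseteq> carrier orth_group"
    using assms(1) by (auto intro!: reflection_in_orth_group)
  interpret group "orth_group :: ('a \<Rightarrow> 'a) monoid" by (rule group_orth_group)
  have w: "w \<in> carrier orth_group" "w \<in> generate orth_group (reflection ` R)"
    using assms(2) generate_in_carrier[OF sub] by (auto simp: reflection_group_def)
  let ?v = "inv\<^bsub>orth_group\<^esub> w"
  have "?v \<in> reflection_group R"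
    using generate_m_inv_closed[OF sub w(2)] by (simp add: reflection_group_def)
  moreover have "?v \<circ> w = id"
    using l_inv[OF w(1)] by (simp add: orth_group_def)
  ultimately show thesis using that by blast
qed

text \<open>Conjugating a reflection by \<open>w\<close> gives the reflection in the image root,
  which stays in \<open>R\<close>; this extends along the generation of the group.\<close>

lemma reflection_group_conjugate:
  assumes "0 \<notin> R" "orthogonal_transformation w" "w ` R \<subseteq> R" "u \<in> reflection_group R"
  shows "\<exists>u'\<in>reflection_group R. w \<circ> u = u' \<circ> w"
proof -
  interpret group "orth_group :: ('a \<Rightarrow> 'a) monoid" by (rule group_orth_group)
  have refl: "\<exists>u'\<in>reflection_group R. w \<circ> reflection a = u' \<circ> w" if "a \<in> R" for a
  proof (rule bexI)
    show "w \<circ> reflection a = reflection (w a) \<circ> w"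
      using reflection_orthogonal_transformation[OF assms(2)] by auto
    show "reflection (w a) \<in> reflection_group R"
      using assms(3) that by (auto intro: reflection_mem_group)
  qed
  have "u \<in> generate orth_group (reflection ` R)"
    using assms(4) by (simp add: reflection_group_def)
  then show ?thesis
  proof induction
    case one
    show ?case using reflection_group_id by (intro bexI[of _ id]) (auto simp: orth_group_def)
  next
    case (incl h)
    then obtain a where a: "a \<in> R" "h = reflection a" by auto
    show ?case unfolding a(2) by (rule refl[OF a(1)])
  next
    case (inv h)
    then obtain a where a: "a \<in> R" "h = reflection a" by auto
    then have "h \<in> carrier orth_group"
      using reflection_in_orth_group[of a] assms(1) by auto
    moreover have "h \<otimes>\<^bsub>orth_group\<^esub> h = \<one>\<^bsub>orth_group\<^esub>"
      using a by (auto simp: orth_group_def)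
    ultimately have inv: "inv\<^bsub>orth_group\<^esub> h = h" using inv_equality by blast
    show ?case unfolding inv unfolding a(2) by (rule refl[OF a(1)])
  next
    case (eng h1 h2)
    obtain u1 where u1: "u1 \<in> reflection_group R" "w \<circ> h1 = u1 \<circ> w"
      using eng.IH(1) by blast
    obtain u2 where u2: "u2 \<in> reflection_group R" "w \<circ> h2 = u2 \<circ> w"
      using eng.IH(2) by blast
    have "w \<circ> (h1 \<circ> h2) = (u1 \<circ> u2) \<circ> w" by (metis comp_assoc u1(2) u2(2))
    moreover have "h1 \<otimes>\<^bsub>orth_group\<^esub> h2 = h1 \<circ> h2" by (simp add: orth_group_def)
    ultimately show ?case using reflection_group_comp[OF u1(1) u2(1)] by metis
  qed
qed

text \<open>Letters rejected by \<open>P\<close> give reflections in \<open>L\<close>. Every letter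
  normalises the group of \<open>L\<close>, so these factors can be collected on the left while the
  remaining letters keep their order.\<close>

lemma reflection_prod_filter:
  assumes "0 \<notin> L" and inv: "\<And>a. a \<in> set l \<Longrightarrow> reflection a ` L \<subseteq> L"
    and "\<And>a. a \<in> set l \<Longrightarrow> \<not> P a \<Longrightarrow> a \<in> L"
  shows "\<exists>u\<in>reflection_group L. reflection_prod l = u \<circ> reflection_prod (filter P l)"
  using assms(2,3)
proof (induction l)
  case Nil
  show ?case using reflection_group_id by (intro bexI[of _ id]) auto
next
  case (Cons a l)
  then obtain u where u: "u \<in> reflection_group L" "reflection_prod l = u \<circ> reflection_prod (filter P l)"
    by (metis list.set_intros(2))
  show ?case
  proof (cases "P a")
    case True
    obtain u' where "u' \<in> reflection_group L" "reflection a \<circ> u = u' \<circ> reflection a"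
      using reflection_group_conjugate[OF assms(1) orthogonal_transformation_reflection _ u(1)] Cons.prems(1)
      by force
    then show ?thesis using True u by (intro bexI[of _ u']) (simp_all add: o_assoc)
  next
    case False
    then have "reflection a \<circ> u \<in> reflection_group L"
      using Cons.prems(2) by (intro reflection_group_comp u reflection_mem_group) auto
    then show ?thesis using False u by (intro bexI[of _ "reflection a \<circ> u"]) (simp_all add: o_assoc)
  qed
qed

text \<open>Since \<open>w\<close> normalises the group, every factor \<open>u\<close> can be moved
  to the left.\<close>

lemma pow_mod_reflection_group:
  assumes "0 \<notin> L" "orthogonal_transformation w" "w ` L \<subseteq> L" "u \<in> reflection_group L"
  shows "\<exists>u'\<in>reflection_group L. (u \<circ> w) ^^ n = u' \<circ> (w ^^ n)"
proof (induction n)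
  case 0
  show ?case using reflection_group_id by (intro bexI[of _ id]) auto
next
  case (Suc n)
  then obtain u1 where u1: "u1 \<in> reflection_group L" "(u \<circ> w) ^^ n = u1 \<circ> (w ^^ n)" by blast
  obtain u2 where u2: "u2 \<in> reflection_group L" "w \<circ> u1 = u2 \<circ> w"
    using reflection_group_conjugate[OF assms(1-3) u1(1)] by blast
  have "(u \<circ> w) ^^ Suc n = u \<circ> (w \<circ> u1) \<circ> (w ^^ n)" by (simp add: u1(2) o_assoc)
  also have "\<dots> = (u \<circ> u2) \<circ> (w ^^ Suc n)" by (simp add: u2(2) o_assoc)
  finally show ?case using reflection_group_comp[OF assms(4) u2(1)] by blast
qed

theorem proposition4p4:
  fixes \<Delta> B B\<^sub>s :: "'a::euclidean_space set"
    and c :: "'a \<Rightarrow> 'a"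
    and h h\<^sub>s :: nat
  assumes "irreducible_root_system \<Delta>"
    and "card (norm ` \<Delta>) = 2"
    and "simple_roots \<Delta> B"
    and "B\<^sub>s = B \<inter> short_roots \<Delta>"
    and "h = coxeter_number \<Delta>"
    and "h\<^sub>s = coxeter_number (\<Delta> \<inter> int_span B\<^sub>s)"
    and "c \<in> weyl_group \<Delta>"
    and "coxeter_element B c"
  shows "c [^]\<^bsub>orth_group\<^esub> h\<^sub>s \<in> reflection_group (long_roots \<Delta>) \<and> h\<^sub>s dvd h"
proof -
  have rs: "root_system \<Delta>" using assms(1) by (simp add: irreducible_root_system_def)
  obtain f where "based_root_system \<Delta> B f" using simple_roots_functional rs assms(3) by blast
  then interpret based_root_system \<Delta> B f .
  let ?L = "long_roots \<Delta>"
  let ?S = "\<Delta> \<inter> int_span B\<^sub>s"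
  have norm_refl: "norm (reflection a b) = norm b" for a b :: 'a
    using orthogonal_transformation_norm[OF orthogonal_transformation_reflection] by blast
  have L\<Delta>: "?L \<subseteq> \<Delta>" and L0: "0 \<notin> ?L"
    using root_system_nonzero[OF rs] by (auto simp: long_roots_def)
  have L_inv: "reflection a ` ?L \<subseteq> ?L" if "a \<in> \<Delta>" for a
    using root_system_reflection[OF rs that] norm_refl by (auto simp: long_roots_def)
  have rsL: "root_system ?L"
    using root_system_closed_subset[OF rs L\<Delta>] L_inv L\<Delta> by blast
  have long_or_short: "a \<in> ?L \<or> a \<in> short_roots \<Delta>" if "a \<in> \<Delta>" for a
  proof -
    obtain x y where xy: "norm ` \<Delta> = {x, y}" "x \<noteq> y" using assms(2) by (meson card_2_iff)
    then have "norm a = Max (norm ` \<Delta>) \<or> norm a = Min (norm ` \<Delta>)"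
      using that by (cases "x < y") auto
    then show ?thesis using that by (auto simp: long_roots_def short_roots_def)
  qed
  have short_not_long: "a \<notin> ?L" if "a \<in> short_roots \<Delta>" for a
  proof
    assume "a \<in> ?L"
    then have "Min (norm ` \<Delta>) = Max (norm ` \<Delta>)"
      using that by (simp add: long_roots_def short_roots_def)
    moreover obtain x y where "norm ` \<Delta> = {x, y}" "x \<noteq> y" using assms(2) by (meson card_2_iff)
    ultimately show False by auto
  qed

  \<comment> \<open>The short simple roots as a base of the roots in their integral span\<close>
  have finBs: "finite B\<^sub>s" "B\<^sub>s \<subseteq> B" using finB assms(4) by auto
  have int_span_mem: "a \<in> int_span B\<^sub>s" if "a \<in> B\<^sub>s" for a
  proof -
    have "a = (\<Sum>x\<in>B\<^sub>s. of_int (if x = a then 1 else 0) *\<^sub>R x)"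
      using that finBs
      by (simp add: if_distrib[where f = "\<lambda>u. u *\<^sub>R _"] if_distrib[where f = of_int] cong: if_cong)
    also have "\<dots> \<in> int_span B\<^sub>s" by (rule int_spanI)
    finally show ?thesis .
  qed
  have rsS: "root_system ?S"
  proof (rule root_system_closed_subset[OF rs])
    fix a b assume ab: "a \<in> ?S" "b \<in> ?S"
    obtain k :: "'a \<Rightarrow> int" where k: "a = (\<Sum>x\<in>B\<^sub>s. of_int (k x) *\<^sub>R x)"
      using ab by (auto elim: int_spanE)
    obtain m :: "'a \<Rightarrow> int" where m: "b = (\<Sum>x\<in>B\<^sub>s. of_int (m x) *\<^sub>R x)"
      using ab by (auto elim: int_spanE)
    obtain n :: int where n: "2 * (b \<bullet> a) / (a \<bullet> a) = of_int n"
      using rs ab unfolding root_system_def by (metis Ints_cases IntD1)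
    have "reflection a b = b - of_int n *\<^sub>R a" by (simp add: reflection_def n)
    also have "\<dots> = (\<Sum>x\<in>B\<^sub>s. of_int (m x - n * k x) *\<^sub>R x)"
      by (simp add: k m scaleR_sum_right scaleR_diff_left sum_subtractf)
    also have "\<dots> \<in> int_span B\<^sub>s" by (rule int_spanI)
    finally have "reflection a b \<in> int_span B\<^sub>s" .
    then show "reflection a b \<in> ?S" using root_system_reflection[OF rs] ab by blast
  qed auto
  have simpS: "simple_roots ?S B\<^sub>s"
    unfolding simple_roots_def
  proof (intro conjI ballI)
    show "B\<^sub>s \<subseteq> ?S" using int_span_mem finBs sub by blast
    show "independent B\<^sub>s" using indep finBs(2) by (rule independent_mono)
    fix b assume b: "b \<in> ?S"
    then obtain m :: "'a \<Rightarrow> int" where m: "b = (\<Sum>x\<in>B\<^sub>s. of_int (m x) *\<^sub>R x)"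
      by (auto elim: int_spanE)
    \<comment> \<open>Padded with zeros on \<open>B\<close>, the integer expansion is compared with
      the one-signed one; uniqueness of coefficients confines the latter to
      \<open>B\<^sub>s\<close>.\<close>
    have m': "b = (\<Sum>x\<in>B. (if x \<in> B\<^sub>s then of_int (m x) else 0) *\<^sub>R x)"
      unfolding m using finBs finB by (intro sum.mono_neutral_cong_left) auto
    obtain k :: "'a \<Rightarrow> nat" where k: "b = (\<Sum>a\<in>B. real (k a) *\<^sub>R a) \<or> b = - (\<Sum>a\<in>B. real (k a) *\<^sub>R a)"
      using simple b unfolding simple_roots_def by blast
    have "k a = 0" if "a \<in> B" "a \<notin> B\<^sub>s" for a
      using k
    proof
      assume "b = (\<Sum>a\<in>B. real (k a) *\<^sub>R a)"
      from coeff_unique[OF this[symmetric, unfolded m'] that(1)] show ?thesis using that by simp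
    next
      assume "b = - (\<Sum>a\<in>B. real (k a) *\<^sub>R a)"
      then have "(\<Sum>a\<in>B. (- real (k a)) *\<^sub>R a) = b" by (simp add: sum_negf)
      from coeff_unique[OF this[unfolded m'] that(1)] show ?thesis using that by simp
    qed
    then have "(\<Sum>a\<in>B. real (k a) *\<^sub>R a) = (\<Sum>a\<in>B\<^sub>s. real (k a) *\<^sub>R a)"
      using finBs finB by (intro sum.mono_neutral_right) auto
    then show "\<exists>k :: 'a \<Rightarrow> nat. b = (\<Sum>a\<in>B\<^sub>s. real (k a) *\<^sub>R a) \<or> b = - (\<Sum>a\<in>B\<^sub>s. real (k a) *\<^sub>R a)"
      using k by metis
  qed

  \<comment> \<open>Coxeter elements modulo the long reflections\<close>
  obtain l where l: "distinct l" "set l = B" "c = reflection_prod l"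
    using assms(8) by (auto simp: coxeter_element_iff)
  define l\<^sub>s where "l\<^sub>s = filter (\<lambda>a. a \<in> B\<^sub>s) l"
  define c\<^sub>s where "c\<^sub>s = reflection_prod l\<^sub>s"
  have ls: "distinct l\<^sub>s" "set l\<^sub>s = B\<^sub>s" using l finBs by (auto simp: l\<^sub>s_def)
  then have cox: "coxeter_element B\<^sub>s c\<^sub>s" by (auto simp: coxeter_element_iff c\<^sub>s_def)
  have orth: "orthogonal_transformation c" "orthogonal_transformation c\<^sub>s"
    using l orthogonal_transformation_reflection_prod by (auto simp: c\<^sub>s_def)
  have h: "c ^^ n = id \<longleftrightarrow> h dvd n" for n
    using coxeter_number_eq_ord[OF rs simple assms(8)] orth_group_ord[OF orth(1)] assms(5) by simp
  have hs: "c\<^sub>s ^^ n = id \<longleftrightarrow> h\<^sub>s dvd n" for n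
    using coxeter_number_eq_ord[OF rsS simpS cox] orth_group_ord[OF orth(2)] assms(6) by simp
  \<comment> \<open>Simple roots outside \<open>B\<^sub>s\<close> are long, so their reflections are
    absorbed into \<open>u\<close>.\<close>
  obtain u where u: "u \<in> reflection_group ?L" "c = u \<circ> c\<^sub>s"
    using reflection_prod_filter[OF L0, of l "\<lambda>a. a \<in> B\<^sub>s"] L_inv sub l long_or_short assms(4)
    unfolding c\<^sub>s_def l\<^sub>s_def by blast
  \<comment> \<open>A short simple reflection makes no positive root negative except its own, which
    is not long.\<close>
  have prod_L: "reflection_prod m b \<in> ?L \<and> 0 < f (reflection_prod m b)"
    if "set m \<subseteq> B\<^sub>s" "b \<in> ?L" "0 < f b" for m b
    using that
  proof (induction m)
    case (Cons a m)
    let ?d = "reflection_prod m b"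
    have d: "?d \<in> ?L" "0 < f ?d" and a: "a \<in> B" "a \<in> short_roots \<Delta>"
      using Cons assms(4) by auto
    then have "a \<noteq> ?d" using short_not_long by blast
    then show ?case
      using d a simple_reflection_pos[OF a(1) _ d(2)] L_inv[of a] L\<Delta> sub by auto
  qed auto
  have cs_pos: "(c\<^sub>s ^^ n) b \<in> ?L \<and> 0 < f ((c\<^sub>s ^^ n) b)" if "b \<in> ?L" "0 < f b" for n b
    using that by (induction n) (use prod_L ls in \<open>auto simp: c\<^sub>s_def\<close>)
  have prod_image_L: "reflection_prod m ` ?L \<subseteq> ?L" if "set m \<subseteq> \<Delta>" for m
    using that by (induction m) (use L_inv in auto)
  have cs_L: "c\<^sub>s ` ?L \<subseteq> ?L"
    using prod_image_L[of l\<^sub>s] ls finBs sub unfolding c\<^sub>s_def by blast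
  have pow: "\<exists>u'\<in>reflection_group ?L. c ^^ n = u' \<circ> (c\<^sub>s ^^ n)" for n
    unfolding u(2) by (rule pow_mod_reflection_group[OF L0 orth(2) cs_L u(1)])
  \<comment> \<open>Since \<open>c\<^sub>s ^^ h\<^sub>s = id\<close>, only the long factor
    remains.\<close>
  have "c ^^ h\<^sub>s \<in> reflection_group ?L"
    using pow[of "h\<^sub>s"] hs[of "h\<^sub>s"] by auto
  moreover have "h\<^sub>s dvd h"
  proof -
    \<comment> \<open>\<open>c ^^ h = id\<close> exhibits \<open>c\<^sub>s ^^ h\<close> as the
      inverse of \<open>u'\<close>, hence as an element of the group of long reflections.\<close>
    obtain u' where u': "u' \<in> reflection_group ?L" "u' \<circ> (c\<^sub>s ^^ h) = id"
      using pow[of h] h[of h] by auto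
    obtain v where v: "v \<in> reflection_group ?L" "v \<circ> u' = id"
      using reflection_group_inverse[OF L0 u'(1)] by blast
    have "c\<^sub>s ^^ h = v" using u'(2) v(2) by (metis comp_assoc comp_id id_comp)
    \<comment> \<open>The functional \<open>f\<close> is regular on the long roots too, and
      \<open>c\<^sub>s\<close> preserves their positive part.\<close>
    then have "c\<^sub>s ^^ h = id"
      using positive_preserving_id[OF rsL lin, of "c\<^sub>s ^^ h"] regular L\<Delta> v(1) cs_pos by blast
    then show ?thesis using hs by blast
  qed
  ultimately show ?thesis by (simp add: orth_group_pow)
qed

end
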